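(* Let $p \ge 2$ and $n$ be integers with $2 \leq n \leq p$. Let $X_1,\dots,X_n$ be independent and identically distributed random vectors with distribution $N_p(\mu,\Sigma)$, where $\mu \in \mathbb{R}^p$ and $\Sigma$ is a positive definite $p\times p$ matrix. Let $X = (X_1,\dots,X_n)$ be the $p\times n$ data matrix, let $\bar{X}$ be the $p\times n$ matrix each of whose columns equals $\frac{1}{n}(X_1+\dots+X_n)$, and let $S = \frac{1}{n}(X-\bar{X})(X-\bar{X})^{\top}$ be the sample covariance matrix. Set $k = p-(n-1)$. Then, with probability $1$, for every $\rho \geq 0$ and every $c>0$ with $c < 1 - \frac{k}{p}$, the PCGLASSO optimisation problem $$\min_{\xi_1,\dots,\xi_p > 0,\ \Delta \in \mathcal{S}_1} \; -\log\det(\Delta) - 2c\sum_{i=1}^p \log(\xi_i) + \mathrm{tr}\left(S\,\xi\,\Delta\,\xi\right) + \rho\sum_{i\neq j}|\Delta_{ij}|$$ has a solution, i.e. the infimum of the objective over the feasible set is attained at some feasible point $(\xi,\Delta)$.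
   Context: Here $\xi = \mathrm{diag}(\xi_1,\dots,\xi_p)$ denotes the $p\times p$ diagonal matrix with positive diagonal entries $\xi_i$, and $\mathcal{S}_1$ denotes the set of $p\times p$ symmetric positive definite matrices with all diagonal entries equal to $1$. The parameter $\rho \ge 0$ weights the $\ell_1$ penalty on the off-diagonal entries of $\Delta$ (the sum is over ordered pairs $i \neq j$ in $\{1,\dots,p\}$), and $c>0$ weights the logarithmic term in the $\xi_i$. The precision-matrix estimate corresponding to a solution is $\Theta = \xi\Delta\xi$. *)

theory Defs
  imports "HOL-Probability.Probability"
begin

definition sym_pos_def_mat :: "real^'p^'p \<Rightarrow> bool" where
  "sym_pos_def_mat A \<longleftrightarrow> transpose A = A \<and> (\<forall>x. x \<noteq> 0 \<longrightarrow> x \<bullet> (A *v x) > 0)"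

definition S1 :: "(real^'p^'p) set" where
  "S1 = {D. sym_pos_def_mat D \<and> (\<forall>i. D $ i $ i = 1)}"

definition diag_mat :: "real^'p \<Rightarrow> real^'p^'p" where
  "diag_mat v = (\<chi> i j. if i = j then v $ i else 0)"

definition mvn_density :: "real^'p \<Rightarrow> real^'p^'p \<Rightarrow> real^'p \<Rightarrow> real" where
  "mvn_density mu Sig x =
     exp (- ((x - mu) \<bullet> (matrix_inv Sig *v (x - mu))) / 2)
     / sqrt ((2 * pi) ^ CARD('p) * det Sig)"

text \<open>Sample covariance S = (1/n) (X - Xbar)(X - Xbar)^T of the columns X 0, ..., X (n-1).\<close>
definition sample_mean :: "nat \<Rightarrow> (nat \<Rightarrow> real^'p) \<Rightarrow> real^'p" where
  "sample_mean n X = (1 / real n) *\<^sub>R (\<Sum>i<n. X i)"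

definition sample_cov :: "nat \<Rightarrow> (nat \<Rightarrow> real^'p) \<Rightarrow> real^'p^'p" where
  "sample_cov n X = (\<chi> a b. (1 / real n) *
      (\<Sum>i<n. (X i $ a - sample_mean n X $ a) * (X i $ b - sample_mean n X $ b)))"

definition pcglasso_obj :: "real^'p^'p \<Rightarrow> real \<Rightarrow> real \<Rightarrow> real^'p \<Rightarrow> real^'p^'p \<Rightarrow> real" where
  "pcglasso_obj S rho c xi D =
     - ln (det D) - 2 * c * (\<Sum>i\<in>UNIV. ln (xi $ i))
     + trace (S ** diag_mat xi ** D ** diag_mat xi)
     + rho * (\<Sum>(i, j) \<in> {(i, j). i \<noteq> j}. \<bar>D $ i $ j\<bar>)"

definition pcglasso_feasible :: "((real^'p) \<times> (real^'p^'p)) set" where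
  "pcglasso_feasible = {(xi, D). (\<forall>i. xi $ i > 0) \<and> D \<in> S1}"

definition pcglasso_has_solution :: "real^'p^'p \<Rightarrow> real \<Rightarrow> real \<Rightarrow> bool" where
  "pcglasso_has_solution S rho c \<longleftrightarrow>
     (\<exists>(xi, D) \<in> pcglasso_feasible. \<forall>(xi', D') \<in> pcglasso_feasible.
        pcglasso_obj S rho c xi D \<le> pcglasso_obj S rho c xi' D')"

end

theory Submission
  imports Defs
begin

text \<open>Put \<open>\<Theta> = \<xi> \<Delta> \<xi>\<close>, \<open>m = n - 1\<close> and \<open>s = \<Sum>\<^sub>i log \<xi>\<^sub>i\<close>. Let \<open>I\<close> be a set of \<open>m\<close> coordinates,
  and let \<open>B\<close> have the differences \<open>X\<^sub>j - X\<^sub>0\<close> as its columns in \<open>I\<close> and the basis vectors \<open>e\<^sub>i\<close> as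
  its other columns. Almost surely all these matrices are invertible: entering the data points one
  at a time, each has to avoid a hyperplane determined by the previous ones.
  Hadamard's inequality for \<open>B\<^sup>T \<Theta> B\<close> bounds \<open>log det \<Delta> + 2 s\<close> by
  \<open>2 \<Sum>\<^sub>i\<^sub>\<notin>\<^sub>I log \<xi>\<^sub>i + m log tr (S \<Theta>)\<close> up to a constant, and since \<open>m log t \<le> t + const\<close>, the objective
  is at least \<open>2 \<Sum>\<^sub>i\<^sub>\<in>\<^sub>I log \<xi>\<^sub>i - 2 c s\<close> up to a constant. For the \<open>m\<close> largest coordinates the sum
  over \<open>I\<close> is at least \<open>(m / p) s\<close>, so \<open>c < m / p\<close> bounds \<open>s\<close> from above on sublevel sets; the trivial
  bound \<open>- log det \<Delta> - 2 c s\<close> bounds \<open>s\<close> from below. It follows that every \<open>log \<xi>\<^sub>i\<close> is bounded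
  and that \<open>det \<Delta>\<close> stays away from \<open>0\<close>, so sublevel sets lie in a compact part of the feasible set.\<close>

subsection \<open>Hadamard's inequality\<close>

lemma matrix_vector_inner_transpose:
  fixes A :: "real^'n^'m"
  shows "x \<bullet> (A *v y) = (transpose A *v x) \<bullet> y"
  by (simp add: dot_lmul_matrix transpose_matrix_vector)

lemma sym_pos_def_matD:
  assumes "sym_pos_def_mat A"
  shows "transpose A = A" "x \<noteq> 0 \<Longrightarrow> x \<bullet> (A *v x) > 0" "x \<bullet> (A *v x) \<ge> 0"
  using assms unfolding sym_pos_def_mat_def
  by (auto, metis inner_zero_left less_eq_real_def)

text \<open>The form at \<open>x + t y\<close> is a nonnegative quadratic in \<open>t\<close>,
  evaluated at its minimum \<open>- b / c\<close>. As \<open>A\<close> is only semidefinite,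
  \<open>c = 0\<close> is possible; the quadratic is then affine in \<open>t\<close>, which forces
  \<open>b = 0\<close>.\<close>

lemma psd_Cauchy_Schwarz:
  fixes A :: "real^'n^'n"
  assumes sym: "transpose A = A" and psd: "\<And>x. x \<bullet> (A *v x) \<ge> 0"
  shows "(x \<bullet> (A *v y))\<^sup>2 \<le> (x \<bullet> (A *v x)) * (y \<bullet> (A *v y))"
proof -
  define a b c where "a = x \<bullet> (A *v x)" and "b = x \<bullet> (A *v y)" and "c = y \<bullet> (A *v y)"
  have sw: "y \<bullet> (A *v x) = b"
    by (metis b_def inner_commute matrix_vector_inner_transpose sym)
  have q: "a + 2 * t * b + t\<^sup>2 * c \<ge> 0" for t
  proof -
    have "(x + t *\<^sub>R y) \<bullet> (A *v (x + t *\<^sub>R y)) = a + 2 * t * b + t\<^sup>2 * c"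
      using sw by (simp add: matrix_vector_right_distrib inner_add_left inner_add_right
          matrix_vector_mult_scaleR a_def b_def c_def power2_eq_square algebra_simps)
    then show ?thesis using psd by metis
  qed
  have "b\<^sup>2 \<le> a * c"
  proof (cases "c = 0")
    case True
    have "b = 0"
    proof (rule ccontr)
      assume "b \<noteq> 0"
      \<comment> \<open>This \<open>t\<close> is where the affine function \<open>a + 2 t b\<close>
        takes the value \<open>-1\<close>.\<close>
      then have "a + 2 * (- (a + 1) / (2 * b)) * b = -1" by (simp add: field_simps)
      with q[of "- (a + 1) / (2 * b)"] True show False by simp
    qed
    with True show ?thesis by simp
  next
    case False
    then have "c > 0" using psd[of y] by (simp add: c_def)
    have "0 \<le> (a + 2 * (- b / c) * b + (- b / c)\<^sup>2 * c) * c"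
      using q[of "- b / c"] \<open>c > 0\<close> by (intro mult_nonneg_nonneg) auto
    also have "\<dots> = a * c - b\<^sup>2"
      using False by (simp add: field_simps power2_eq_square)
    finally show ?thesis by simp
  qed
  then show ?thesis by (simp add: a_def b_def c_def)
qed

lemma inner_axis_matrix_axis:
  fixes A :: "real^'n^'n"
  shows "axis i 1 \<bullet> (A *v axis j 1) = A $ i $ j"
  by (simp add: matrix_vector_mult_basis inner_axis' column_def)

lemma sym_pos_def_mat_diag_pos:
  assumes "sym_pos_def_mat A" shows "A $ i $ i > 0"
  using sym_pos_def_matD(2)[OF assms, of "axis i 1"] by (simp add: inner_axis_matrix_axis axis_eq_0_iff)

lemma sym_pos_def_mat_invertible:
  assumes "sym_pos_def_mat A" shows "invertible A"
  using assms sym_pos_def_matD(2)[OF assms]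
  unfolding invertible_left_inverse matrix_left_invertible_ker
  by (metis inner_zero_right less_irrefl)

text \<open>If the form vanishes at \<open>x\<close>, Cauchy--Schwarz against \<open>A x\<close>
  gives \<open>A x = 0\<close>. This recovers the open condition of definiteness from closed
  conditions, as compactness will require.\<close>

lemma psd_det_nz_imp_sym_pos_def_mat:
  fixes A :: "real^'n^'n"
  assumes sym: "transpose A = A" and psd: "\<And>x. x \<bullet> (A *v x) \<ge> 0" and "det A \<noteq> 0"
  shows "sym_pos_def_mat A"
proof -
  have "x \<bullet> (A *v x) > 0" if "x \<noteq> 0" for x
  proof (rule ccontr)
    assume "\<not> ?thesis"
    then have "x \<bullet> (A *v x) = 0" using psd[of x] by simp
    then have "((A *v x) \<bullet> (A *v x))\<^sup>2 \<le> 0"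
      using psd_Cauchy_Schwarz[OF sym psd, of "A *v x" x] by simp
    then have "A *v x = 0" by simp
    moreover have "invertible A" using \<open>det A \<noteq> 0\<close> by (simp add: invertible_det_nz)
    ultimately show False using that
      unfolding invertible_left_inverse matrix_left_invertible_ker by blast
  qed
  with sym show ?thesis by (simp add: sym_pos_def_mat_def)
qed

lemma congruence_inner:
  fixes A B :: "real^'n^'n"
  shows "x \<bullet> ((transpose B ** A ** B) *v y) = (B *v x) \<bullet> (A *v (B *v y))"
proof -
  have "x \<bullet> ((transpose B ** A ** B) *v y) = x \<bullet> (transpose B *v (A *v (B *v y)))"
    by (simp only: matrix_vector_mul_assoc matrix_mul_assoc)
  also have "\<dots> = (B *v x) \<bullet> (A *v (B *v y))"
    by (simp only: transpose_matrix_vector inner_commute[of x] dot_lmul_matrix) (rule inner_commute)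
  finally show ?thesis .
qed

lemma sym_pos_def_mat_congruence:
  fixes A B :: "real^'n^'n"
  assumes A: "sym_pos_def_mat A" and "det B \<noteq> 0"
  shows "sym_pos_def_mat (transpose B ** A ** B)"
proof -
  have inv: "invertible B" using assms by (simp add: invertible_det_nz)
  have "transpose (transpose B ** A ** B) = transpose B ** A ** B"
    by (simp add: matrix_transpose_mul sym_pos_def_matD(1)[OF A] matrix_mul_assoc)
  moreover have "x \<bullet> ((transpose B ** A ** B) *v x) > 0" if "x \<noteq> 0" for x
  proof -
    have "x \<bullet> ((transpose B ** A ** B) *v x) = (B *v x) \<bullet> (A *v (B *v x))"
      by (rule congruence_inner)
    moreover have "B *v x \<noteq> 0"
      using inv that unfolding invertible_left_inverse matrix_left_invertible_ker by blast
    ultimately show ?thesis using sym_pos_def_matD(2)[OF A] by simp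
  qed
  ultimately show ?thesis by (simp add: sym_pos_def_mat_def)
qed

lemma congruence_diag:
  fixes A B :: "real^'n^'n"
  shows "(transpose B ** A ** B) $ i $ i = column i B \<bullet> (A *v column i B)"
proof -
  have "(transpose B ** A ** B) $ i $ i = axis i 1 \<bullet> ((transpose B ** A ** B) *v axis i 1)"
    by (simp add: inner_axis_matrix_axis)
  also have "\<dots> = (B *v axis i 1) \<bullet> (A *v (B *v axis i 1))"
    by (rule congruence_inner)
  finally show ?thesis by (simp add: matrix_vector_mult_basis)
qed

text \<open>Row and column \<open>k\<close> become those of the identity. The determinant is thus
  the principal minor without index \<open>k\<close>, while the matrix keeps its type, so that
  induction needs no smaller index type.\<close>

definition isolate_index :: "'n \<Rightarrow> real^'n^'n \<Rightarrow> real^'n^'n" where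
  "isolate_index k A = (\<chi> i j. if i = k \<or> j = k then of_bool (i = j) else A $ i $ j)"

text \<open>The left-hand matrix, with only column \<open>k\<close> replaced, is the one in Cramer's
  rule. Row \<open>k\<close> splits as the basis vector plus a remainder, and the remainder
  contributes a matrix whose column \<open>k\<close> is zero.\<close>

lemma det_isolate_index:
  fixes A :: "real^'n^'n"
  shows "det (\<chi> i j. if j = k then axis k 1 $ i else A $ i $ j) = det (isolate_index k A)"
proof -
  let ?c = "\<lambda>i. \<chi> j. if j = k then axis k 1 $ i else A $ i $ j"
  have "det (\<chi> i. if i = k then axis k 1 + (\<chi> j. if j = k then 0 else A $ k $ j) else ?c i)
      = det (\<chi> i. if i = k then axis k 1 else ?c i)
        + det (\<chi> i. if i = k then (\<chi> j. if j = k then 0 else A $ k $ j) else ?c i)"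
    by (rule det_row_add)
  moreover have "det (\<chi> i. if i = k then (\<chi> j. if j = k then 0 else A $ k $ j) else ?c i) = 0"
    by (rule det_zero_column[of k]) (auto simp: column_def vec_eq_iff axis_def)
  moreover have "(\<chi> i. if i = k then axis k 1 + (\<chi> j. if j = k then 0 else A $ k $ j) else ?c i)
      = (\<chi> i j. if j = k then axis k 1 $ i else A $ i $ j)"
    by (auto simp: vec_eq_iff axis_def)
  moreover have "(\<chi> i. if i = k then axis k 1 else ?c i) = isolate_index k A"
    by (auto simp: vec_eq_iff axis_def isolate_index_def)
  ultimately show ?thesis by simp
qed

text \<open>The quadratic form decouples into \<open>(x $ k)\<^sup>2\<close> and the form of
  \<open>A\<close> at \<open>x\<close> with coordinate \<open>k\<close> set to zero.\<close>

lemma sym_pos_def_mat_isolate_index: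
  fixes A :: "real^'n^'n"
  assumes A: "sym_pos_def_mat A"
  shows "sym_pos_def_mat (isolate_index k A)"
proof -
  have sym: "A $ i $ j = A $ j $ i" for i j
    using sym_pos_def_matD(1)[OF A] by (metis transpose_def vec_lambda_beta)
  have "transpose (isolate_index k A) = isolate_index k A"
    by (auto simp: vec_eq_iff transpose_def isolate_index_def sym)
  moreover have "x \<bullet> (isolate_index k A *v x) > 0" if "x \<noteq> 0" for x
  proof -
    define y where "y = (\<chi> i. if i = k then 0 else x $ i)"
    have comp: "(isolate_index k A *v x) $ i = (if i = k then x $ k else (A *v y) $ i)" for i
      unfolding matrix_vector_mult_def isolate_index_def y_def
      by (auto intro!: sum.cong simp: if_distrib cong: if_cong)
    have "x \<bullet> (isolate_index k A *v x) = (\<Sum>i\<in>UNIV. x $ i * (if i = k then x $ k else (A *v y) $ i))"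
      by (simp add: inner_vec_def comp)
    also have "\<dots> = (\<Sum>i\<in>UNIV. (if i = k then (x $ k)\<^sup>2 else 0) + y $ i * (A *v y) $ i)"
      by (rule sum.cong) (auto simp: y_def power2_eq_square)
    also have "\<dots> = (x $ k)\<^sup>2 + y \<bullet> (A *v y)"
      by (simp add: sum.distrib inner_vec_def)
    finally have eq: "x \<bullet> (isolate_index k A *v x) = (x $ k)\<^sup>2 + y \<bullet> (A *v y)" .
    show ?thesis
    proof (cases "y = 0")
      case True
      then have "x $ k \<noteq> 0" using that by (auto simp: y_def vec_eq_iff split: if_splits)
      then show ?thesis using eq True by simp
    next
      case False
      then show ?thesis using eq sym_pos_def_matD(2)[OF A False]
        by (simp add: add_nonneg_pos)
    qed
  qed
  ultimately show ?thesis by (simp add: sym_pos_def_mat_def)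
qed

text \<open>With \<open>A x = e\<^sub>k\<close>, Cramer's rule gives \<open>x\<^sub>k det A = det (isolate_index k A)\<close>, and
  Cauchy--Schwarz for the inner product of \<open>A\<close>, applied to \<open>x\<close> and \<open>e\<^sub>k\<close>, gives
  \<open>1 \<le> x\<^sub>k A\<^sub>k\<^sub>k\<close>.\<close>
lemma det_le_isolate_index:
  fixes A :: "real^'n^'n"
  assumes A: "sym_pos_def_mat A" and pos: "det (isolate_index k A) > 0"
  shows "0 < det A" "det A \<le> A $ k $ k * det (isolate_index k A)"
proof -
  obtain x where x: "A *v x = axis k 1"
    using sym_pos_def_mat_invertible[OF A]
    by (metis invertible_right_inverse matrix_right_invertible_surjective surjD)
  have cr: "x $ k * det A = det (isolate_index k A)"
    using cramer_lemma[where A=A and x=x and k=k] by (simp only: x det_isolate_index)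
  have "x \<noteq> 0" using x by (metis axis_eq_0_iff matrix_vector_mult_0_right zero_neq_one)
  then have xk: "x $ k > 0"
    using sym_pos_def_matD(2)[OF A, of x] by (simp add: x inner_axis)
  have "(axis k 1 \<bullet> (A *v x))\<^sup>2 \<le> A $ k $ k * (x \<bullet> (A *v x))"
    using psd_Cauchy_Schwarz[OF sym_pos_def_matD(1,3)[OF A], of "axis k 1" x]
    by (simp add: inner_axis_matrix_axis)
  then have 1: "1 \<le> A $ k $ k * x $ k"
    by (simp add: x inner_axis)
  show "0 < det A" using cr pos xk by (metis zero_less_mult_pos)
  then have "1 * det A \<le> (A $ k $ k * x $ k) * det A"
    using 1 by (intro mult_right_mono) auto
  then show "det A \<le> A $ k $ k * det (isolate_index k A)"
    by (simp add: cr[symmetric] mult.assoc)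
qed

text \<open>Induction on the set \<open>J\<close> off which \<open>A\<close> agrees with the
  identity: isolating \<open>k\<close> passes from \<open>insert k J\<close> to \<open>J\<close>.
  Positivity of the determinant is carried along because \<open>det_le_isolate_index\<close> needs
  it for the isolated matrix.\<close>

lemma Hadamard_inequality_on:
  fixes A :: "real^'n^'n"
  assumes "finite J" "sym_pos_def_mat A"
    "\<And>i j. i \<notin> J \<or> j \<notin> J \<Longrightarrow> A $ i $ j = of_bool (i = j)"
  shows "0 < det A \<and> det A \<le> (\<Prod>k\<in>J. A $ k $ k)"
  using assms
proof (induction J arbitrary: A rule: finite_induct)
  case empty
  then have "A = mat 1" by (simp add: vec_eq_iff mat_def)
  then show ?case by simp
next
  case (insert k J)
  let ?P = "isolate_index k A"
  have off: "?P $ i $ j = of_bool (i = j)" if "i \<notin> J \<or> j \<notin> J" for i j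
    using insert.prems(2)[of i j] that by (auto simp: isolate_index_def)
  have *: "0 < det ?P \<and> det ?P \<le> (\<Prod>j\<in>J. ?P $ j $ j)"
    using insert.IH[OF sym_pos_def_mat_isolate_index[OF insert.prems(1), of k]] off by blast
  have "(\<Prod>j\<in>J. ?P $ j $ j) = (\<Prod>j\<in>J. A $ j $ j)"
    using insert.hyps by (intro prod.cong) (auto simp: isolate_index_def)
  then have "A $ k $ k * det ?P \<le> A $ k $ k * (\<Prod>j\<in>J. A $ j $ j)"
    using * sym_pos_def_mat_diag_pos[OF insert.prems(1), of k] by (intro mult_left_mono) auto
  moreover have "0 < det A" "det A \<le> A $ k $ k * det ?P"
    using det_le_isolate_index[OF insert.prems(1)] * by blast+
  ultimately show ?case using insert.hyps by simp
qed

lemma Hadamard_inequality: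
  fixes A :: "real^'n^'n"
  assumes "sym_pos_def_mat A"
  shows "0 < det A" "det A \<le> (\<Prod>k\<in>UNIV. A $ k $ k)"
  using Hadamard_inequality_on[of UNIV A] assms by auto

subsection \<open>General position of Gaussian data\<close>

text \<open>The label \<open>0\<close> marks the indices whose basis vector is kept; the others are labelled
  injectively by data points other than \<open>x 0\<close>. The differences \<open>x j - x 0\<close> replace the centred
  data, with which they share their span.\<close>
definition frame_mat :: "('p \<Rightarrow> nat) \<Rightarrow> (nat \<Rightarrow> real^'p) \<Rightarrow> real^'p^'p" where
  "frame_mat s x = (\<chi> a i. if s i = 0 then axis i 1 $ a else (x (s i) - x 0) $ a)"

definition labelling :: "nat \<Rightarrow> ('p \<Rightarrow> nat) \<Rightarrow> bool" where
  "labelling n s \<longleftrightarrow> range s \<subseteq> {..<n} \<and> inj_on s {i. s i \<noteq> 0}"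

lemma AE_lborel_hyperplane:
  fixes r :: "'a::euclidean_space"
  assumes "r \<noteq> 0"
  shows "AE y in lborel. r \<bullet> y \<noteq> b"
proof -
  have "{y. r \<bullet> y = b} \<in> null_sets lebesgue"
    using negligible_hyperplane[of r b] assms by (simp add: negligible_iff_null_sets)
  moreover have "{y. r \<bullet> y = b} \<in> sets lborel"
    by (simp add: closed_hyperplane borel_closed)
  ultimately have "{y. r \<bullet> y = b} \<in> null_sets lborel"
    by (simp add: null_sets_completion_iff)
  then show ?thesis by (auto dest: AE_not_in)
qed

text \<open>Independence makes the joint law of \<open>Z\<close> and \<open>W\<close> a product, so
  Fubini allows \<open>z\<close> to be fixed; the density of \<open>g (W \<omega>)\<close> then
  turns a Lebesgue-null exception into a null event. The map \<open>g\<close> serves to read a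
  vector off a one-point product space.\<close>

lemma (in prob_space) AE_indep_var_distributed:
  fixes g :: "'c \<Rightarrow> 'b::euclidean_space"
  assumes ind: "indep_var N Z L W"
    and g[measurable]: "g \<in> measurable L borel"
    and Y: "distributed M lborel (\<lambda>\<omega>. g (W \<omega>)) f"
    and Q[measurable]: "Measurable.pred (N \<Otimes>\<^sub>M borel) (\<lambda>(z, y). Q z y)"
    and AE: "\<And>z. z \<in> space N \<Longrightarrow> AE y in lborel. Q z y"
  shows "AE \<omega> in M. Q (Z \<omega>) (g (W \<omega>))"
proof -
  have Z[measurable]: "Z \<in> measurable M N" and W[measurable]: "W \<in> measurable M L"
    using ind by (auto dest: indep_var_rv1 indep_var_rv2)
  have f: "f \<in> borel_measurable lborel"
    using Y by (rule distributed_borel_measurable)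
  have "distr (distr M L W) borel g = distr M lborel (\<lambda>\<omega>. g (W \<omega>))"
    by (subst distr_distr) (auto intro!: distr_cong simp: comp_def)
  then have dY: "distr (distr M L W) borel g = density lborel f"
    using distributed_distr_eq_density[OF Y] by simp
  have eq: "distr M N Z \<Otimes>\<^sub>M distr M L W = distr M (N \<Otimes>\<^sub>M L) (\<lambda>\<omega>. (Z \<omega>, W \<omega>))"
    using ind unfolding indep_var_distribution_eq by blast
  interpret PZ: prob_space "distr M N Z" by (rule prob_space_distr) simp
  interpret PW: prob_space "distr M L W" by (rule prob_space_distr) simp
  interpret ZW: pair_sigma_finite "distr M N Z" "distr M L W" ..
  have Qg: "Measurable.pred (N \<Otimes>\<^sub>M L) (\<lambda>p. Q (fst p) (g (snd p)))"
    using measurable_compose[of "\<lambda>p. (fst p, g (snd p))" "N \<Otimes>\<^sub>M L" "N \<Otimes>\<^sub>M borel", OF _ Q]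
    by simp
  have "AE p in distr M N Z \<Otimes>\<^sub>M distr M L W. Q (fst p) (g (snd p))"
  proof (rule ZW.AE_pair_measure)
    show "{p \<in> space (distr M N Z \<Otimes>\<^sub>M distr M L W). Q (fst p) (g (snd p))}
        \<in> sets (distr M N Z \<Otimes>\<^sub>M distr M L W)"
      unfolding eq using Qg by simp
    show "AE z in distr M N Z. AE w in distr M L W. Q (fst (z, w)) (g (snd (z, w)))"
    proof (rule AE_I2)
      fix z assume "z \<in> space (distr M N Z)"
      then have "AE y in lborel. Q z y" using AE by simp
      then have "AE y in distr (distr M L W) borel g. Q z y"
        unfolding dY AE_density[OF f] by auto
      then have "AE w in distr M L W. Q z (g w)"
        by (rule AE_distrD[rotated]) simp
      then show "AE w in distr M L W. Q (fst (z, w)) (g (snd (z, w)))" by simp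
    qed
  qed
  then have "AE \<omega> in M. Q (fst (Z \<omega>, W \<omega>)) (g (snd (Z \<omega>, W \<omega>)))"
    unfolding eq by (rule AE_distrD[rotated]) simp
  then show ?thesis by simp
qed

lemma borel_measurable_det:
  fixes A :: "'a \<Rightarrow> real^'n^'n"
  assumes "\<And>i j. (\<lambda>w. A w $ i $ j) \<in> borel_measurable M"
  shows "(\<lambda>w. det (A w)) \<in> borel_measurable M"
  unfolding det_def using assms by measurable

lemma frame_mat_component_measurable:
  assumes "range s \<subseteq> J" "0 \<in> J" and "\<And>j. j \<in> J \<Longrightarrow> (\<lambda>w. x w j) \<in> borel_measurable M"
  shows "(\<lambda>w. frame_mat s (x w) $ a $ i) \<in> borel_measurable M"
proof -
  have comp: "(\<lambda>w. x w j $ a) \<in> borel_measurable M" if "j \<in> J" for j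
    using borel_measurable_inner[OF assms(3)[OF that] borel_measurable_const[of "axis a 1"]]
    by (simp add: inner_axis)
  show ?thesis
  proof (cases "s i = 0")
    case False
    have "(\<lambda>w. x w (s i) $ a - x w 0 $ a) \<in> borel_measurable M"
      using assms(1,2) by (intro borel_measurable_diff comp) auto
    with False show ?thesis by (simp add: frame_mat_def)
  qed (simp add: frame_mat_def)
qed

text \<open>By Cramer's rule the determinant is linear in the replaced column, with coefficient
  vector \<open>r\<close> up to the factor \<open>det A\<close>. Putting the original column back
  gives \<open>det A\<close>, so \<open>r\<close> is nonzero and the bad \<open>y\<close> form a
  hyperplane.\<close>

lemma AE_det_column_replace_nz:
  fixes A :: "real^'n^'n"
  assumes "det A \<noteq> 0"
  shows "AE y in lborel. det (\<chi> i j. if j = k then (y - b) $ i else A $ i $ j) \<noteq> 0"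
proof -
  obtain A' :: "real^'n^'n" where A': "A ** A' = mat 1"
    using assms by (metis invertible_def invertible_det_nz)
  define r where "r = row k A'"
  have nth: "(A' *v v) $ k = r \<bullet> v" for v
    by (simp add: r_def matrix_vector_mul_component row_def)
  have det: "det (\<chi> i j. if j = k then v $ i else A $ i $ j) = (r \<bullet> v) * det A" for v
  proof -
    have v: "A *v (A' *v v) = v"
      by (simp add: matrix_vector_mul_assoc A')
    then show ?thesis
      using cramer_lemma[where A=A and k=k and x="A' *v v"] by (simp only: nth v)
  qed
  have "r \<noteq> 0"
  proof
    assume "r = 0"
    then have "det (\<chi> i j. if j = k then column k A $ i else A $ i $ j) = 0"
      using det by simp
    moreover have "(\<chi> i j. if j = k then column k A $ i else A $ i $ j) = A"
      by (simp add: vec_eq_iff column_def)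
    ultimately show False using assms by simp
  qed
  from AE_lborel_hyperplane[OF this, of "r \<bullet> b"] show ?thesis
    by (simp only: det) (simp add: inner_diff_right assms)
qed

text \<open>Induction on the number \<open>k\<close> of data points available as labels. A frame
  using the newest point arises from an earlier frame, independent of that point, by replacing a
  single column.\<close>

lemma (in prob_space) AE_frame_mat_nonsingular:
  fixes X :: "nat \<Rightarrow> 'a \<Rightarrow> real^'p"
  assumes ind: "indep_vars (\<lambda>_. borel) X {..<n}"
    and dist: "\<And>i. i < n \<Longrightarrow> distributed M lborel (X i) (f i)"
    and "k \<le> n" and "labelling k s"
  shows "AE \<omega> in M. det (frame_mat s (\<lambda>i. X i \<omega>)) \<noteq> 0"
  using assms(3,4)
proof (induction k arbitrary: s)
  case 0
  \<comment> \<open>No labelling exists here, since \<open>range s\<close> is nonempty.\<close>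
  then show ?case by (auto simp: labelling_def)
next
  case (Suc k)
  show ?case
  proof (cases "k = 0 \<or> k \<notin> range s")
    case True
    show ?thesis
    proof (cases "k = 0")
      case True
      then have "s i = 0" for i using Suc.prems(2) by (auto simp: labelling_def)
      then have "frame_mat s x = mat 1" for x
        by (auto simp: frame_mat_def vec_eq_iff mat_def axis_def)
      then show ?thesis by simp
    next
      case False
      then have "labelling k s"
        using True Suc.prems(2) by (auto simp: labelling_def image_subset_iff less_Suc_eq)
      with Suc show ?thesis by simp
    qed
  next
    case False
    then obtain i0 where i0: "s i0 = k" and k: "k \<noteq> 0" by auto
    \<comment> \<open>Restores the basis vector in the only column that uses point
      \<open>k\<close>.\<close>
    define s' where "s' = s(i0 := 0)"
    have inj: "i = i0" if "s i = k" for i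
      using Suc.prems(2) that i0 k unfolding labelling_def inj_on_def by auto
    have s': "s' i < k" for i
    proof (cases "i = i0")
      case False
      have "s i < Suc k" using Suc.prems(2) by (auto simp: labelling_def image_subset_iff)
      with inj[of i] False show ?thesis by (auto simp: s'_def less_Suc_eq)
    qed (use k in \<open>simp add: s'_def\<close>)
    have lab: "labelling k s'"
      using s' Suc.prems(2) by (auto simp: labelling_def inj_on_def image_subset_iff) (auto simp: s'_def split: if_splits)
    have IH: "AE \<omega> in M. det (frame_mat s' (\<lambda>i. X i \<omega>)) \<noteq> 0"
      using Suc lab by simp
    have upd: "frame_mat s (z(k := y))
      = (\<chi> a i. if i = i0 then (y - z 0) $ a else frame_mat s' z $ a $ i)" for z y
    proof -
      have "frame_mat s (z(k := y)) $ a $ i = (if i = i0 then (y - z 0) $ a else frame_mat s' z $ a $ i)" for a i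
      proof (cases "i = i0")
        case True
        then show ?thesis using i0 k by (simp add: frame_mat_def)
      next
        case False
        then have "s i \<noteq> k" using inj by blast
        with False k show ?thesis by (simp add: frame_mat_def s'_def)
      qed
      then show ?thesis by (simp add: vec_eq_iff)
    qed
    define N where "N = PiM {..<k} (\<lambda>_. borel :: (real^'p) measure)"
    define Z where "Z = (\<lambda>\<omega>. restrict (\<lambda>i. X i \<omega>) {..<k})"
    define L where "L = PiM {k} (\<lambda>_. borel :: (real^'p) measure)"
    define W where "W = (\<lambda>\<omega>. restrict (\<lambda>i. X i \<omega>) {k})"
    have indZ: "indep_var N Z L W"
      unfolding N_def Z_def L_def W_def
      using Suc.prems(1) by (intro indep_var_restrict[OF ind]) auto
    have Wk: "W \<omega> k = X k \<omega>" for \<omega> by (simp add: W_def)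
    have compN: "(\<lambda>w. w i) \<in> borel_measurable N" if "i < k" for i
      using that unfolding N_def by (intro measurable_component_singleton) auto
    \<comment> \<open>Nonsingularity of the old frame is a premise inside \<open>Q\<close>, so that
      \<open>Q z\<close> holds almost everywhere for every \<open>z\<close>, not just for almost
      every one.\<close>
    define Q where "Q = (\<lambda>z y. det (frame_mat s' z) \<noteq> 0 \<longrightarrow> det (frame_mat s (z(k := y))) \<noteq> 0)"
    have m1[measurable]: "(\<lambda>p. det (frame_mat s' (fst p))) \<in> borel_measurable (N \<Otimes>\<^sub>M (borel :: (real^'p) measure))"
      using s' k compN
      by (intro borel_measurable_det frame_mat_component_measurable[where J="{..<k}"]
          measurable_compose[OF measurable_fst]) auto
    have m2[measurable]: "(\<lambda>p. det (frame_mat s ((fst p)(k := snd p)))) \<in> borel_measurable (N \<Otimes>\<^sub>M (borel :: (real^'p) measure))"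
    proof (intro borel_measurable_det frame_mat_component_measurable[where J="{..<Suc k}"])
      show "range s \<subseteq> {..<Suc k}" using Suc.prems(2) by (simp add: labelling_def)
      fix j assume "j \<in> {..<Suc k}"
      then show "(\<lambda>p. ((fst p)(k := snd p)) j) \<in> borel_measurable (N \<Otimes>\<^sub>M (borel :: (real^'p) measure))"
        using measurable_compose[OF measurable_fst compN[of j]] by (cases "j = k") auto
    qed simp
    have "AE \<omega> in M. Q (Z \<omega>) (W \<omega> k)"
    proof (rule AE_indep_var_distributed[OF indZ, where g="\<lambda>w. w k"])
      show "(\<lambda>w. w k) \<in> measurable L borel"
        unfolding L_def by (intro measurable_component_singleton) simp
      show "distributed M lborel (\<lambda>\<omega>. W \<omega> k) (f k)"
        using dist[of k] Suc.prems(1) by (simp add: Wk)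
      show "Measurable.pred (N \<Otimes>\<^sub>M borel) (\<lambda>(z, y). Q z y)"
        unfolding Q_def case_prod_beta by measurable
      show "AE y in lborel. Q z y" for z
      proof (cases "det (frame_mat s' z) = 0")
        case False
        from AE_det_column_replace_nz[OF this, of i0 "z 0"] show ?thesis
          by (simp add: Q_def upd)
      qed (simp add: Q_def)
    qed
    moreover have "frame_mat s' (Z \<omega>) = frame_mat s' (\<lambda>i. X i \<omega>)" for \<omega>
      using s' k by (simp add: frame_mat_def Z_def vec_eq_iff)
    moreover have "frame_mat s ((Z \<omega>)(k := X k \<omega>)) = frame_mat s (\<lambda>i. X i \<omega>)" for \<omega>
    proof -
      have "((Z \<omega>)(k := X k \<omega>)) (s i) = X (s i) \<omega>" for i
        using Suc.prems(2) by (auto simp: labelling_def image_subset_iff less_Suc_eq Z_def)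
      moreover have "((Z \<omega>)(k := X k \<omega>)) 0 = X 0 \<omega>"
        using k by (simp add: Z_def)
      ultimately show ?thesis by (simp only: frame_mat_def)
    qed
    ultimately have "AE \<omega> in M. det (frame_mat s' (\<lambda>i. X i \<omega>)) \<noteq> 0
        \<longrightarrow> det (frame_mat s (\<lambda>i. X i \<omega>)) \<noteq> 0"
      by (simp add: Q_def Wk)
    with IH show ?thesis by (rule AE_mp)
  qed
qed

subsection \<open>Lower bounds for the objective\<close>

lemma S1D:
  assumes "D \<in> S1" shows "sym_pos_def_mat D" "D $ i $ i = 1"
  using assms by (auto simp: S1_def)

lemma transpose_diag_mat: "transpose (diag_mat v) = diag_mat v"
  by (auto simp: vec_eq_iff transpose_def diag_mat_def)

lemma det_diag_mat: "det (diag_mat v) = (\<Prod>i\<in>UNIV. v $ i)"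
  by (subst det_diagonal) (auto simp: diag_mat_def)

text \<open>The precision matrix \<open>\<Theta>\<close> of the pair \<open>(xi, D)\<close>.\<close>

definition rescaled :: "real^'p \<Rightarrow> real^'p^'p \<Rightarrow> real^'p^'p" where
  "rescaled xi D = diag_mat xi ** D ** diag_mat xi"

lemma rescaled_congruence: "rescaled xi D = transpose (diag_mat xi) ** D ** diag_mat xi"
  by (simp add: rescaled_def transpose_diag_mat)

lemma rescaled_nth: "rescaled xi D $ i $ j = xi $ i * D $ i $ j * xi $ j"
  unfolding rescaled_def matrix_matrix_mult_def diag_mat_def
  by (simp add: if_distrib if_distribR cong: if_cong)

lemma sym_pos_def_mat_rescaled:
  assumes "sym_pos_def_mat D" "\<And>i. xi $ i > 0"
  shows "sym_pos_def_mat (rescaled xi D)"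
  unfolding rescaled_congruence
  by (rule sym_pos_def_mat_congruence[OF assms(1)])
     (use assms(2) in \<open>auto simp: det_diag_mat less_imp_neq[symmetric]\<close>)

text \<open>The sample covariance is an average of rank-one matrices, each contributing one value of
  the quadratic form.\<close>

lemma trace_sample_cov:
  "trace (sample_cov n x ** A) = (1 / real n) *
     (\<Sum>i<n. (x i - sample_mean n x) \<bullet> (A *v (x i - sample_mean n x)))"
proof -
  define y where "y = (\<lambda>i. x i - sample_mean n x)"
  have "trace (sample_cov n x ** A)
      = (\<Sum>a\<in>UNIV. \<Sum>b\<in>UNIV. (1 / real n) * (\<Sum>i<n. y i $ a * y i $ b) * A $ b $ a)"
    by (simp add: trace_def matrix_matrix_mult_def sample_cov_def y_def)
  also have "\<dots> = (\<Sum>b\<in>UNIV. \<Sum>a\<in>UNIV. (1 / real n) * (\<Sum>i<n. y i $ a * y i $ b) * A $ b $ a)"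
    by (rule sum.swap)
  also have "\<dots> = (\<Sum>b\<in>UNIV. \<Sum>a\<in>UNIV. \<Sum>i<n. (1 / real n) * (y i $ b * (A $ b $ a * y i $ a)))"
    by (simp add: sum_distrib_left sum_distrib_right mult_ac)
  also have "\<dots> = (\<Sum>b\<in>UNIV. \<Sum>i<n. \<Sum>a\<in>UNIV. (1 / real n) * (y i $ b * (A $ b $ a * y i $ a)))"
    by (intro sum.cong refl) (rule sum.swap)
  also have "\<dots> = (\<Sum>i<n. \<Sum>b\<in>UNIV. \<Sum>a\<in>UNIV. (1 / real n) * (y i $ b * (A $ b $ a * y i $ a)))"
    by (rule sum.swap)
  also have "\<dots> = (1 / real n) * (\<Sum>i<n. y i \<bullet> (A *v y i))"
    by (simp add: inner_vec_def matrix_vector_mult_def sum_distrib_left)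
  finally show ?thesis by (simp add: y_def)
qed

lemma pcglasso_obj_rescaled:
  "pcglasso_obj S rho c xi D = - ln (det D) - 2 * c * (\<Sum>i\<in>UNIV. ln (xi $ i))
     + trace (S ** rescaled xi D) + rho * (\<Sum>(i, j) \<in> {(i, j). i \<noteq> j}. \<bar>D $ i $ j\<bar>)"
  by (simp add: pcglasso_obj_def rescaled_def matrix_mul_assoc)

lemma pcglasso_obj_ge_logdet:
  assumes D: "D \<in> S1" and xi: "\<And>i. xi $ i > 0" and "rho \<ge> 0"
  shows "pcglasso_obj (sample_cov n x) rho c xi D \<ge> - ln (det D) - 2 * c * (\<Sum>i\<in>UNIV. ln (xi $ i))"
    and "ln (det D) \<le> 0"
proof -
  have "0 < det D" "det D \<le> 1"
    using Hadamard_inequality[OF S1D(1)[OF D]] by (simp_all add: S1D(2)[OF D])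
  then show "ln (det D) \<le> 0" by simp
  have "trace (sample_cov n x ** rescaled xi D) \<ge> 0"
    unfolding trace_sample_cov
    using sym_pos_def_matD(3)[OF sym_pos_def_mat_rescaled[OF S1D(1)[OF D] xi]]
    by (intro mult_nonneg_nonneg sum_nonneg) auto
  moreover have "rho * (\<Sum>(i, j) \<in> {(i, j). i \<noteq> j}. \<bar>D $ i $ j\<bar>) \<ge> 0"
    using assms by (intro mult_nonneg_nonneg sum_nonneg) auto
  ultimately show "pcglasso_obj (sample_cov n x) rho c xi D
      \<ge> - ln (det D) - 2 * c * (\<Sum>i\<in>UNIV. ln (xi $ i))"
    by (simp add: pcglasso_obj_rescaled)
qed

text \<open>The parallelogram identity with the nonnegative term at \<open>u + v\<close>
  dropped.\<close>

lemma psd_diff_le: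
  fixes A :: "real^'n^'n"
  assumes "\<And>x. x \<bullet> (A *v x) \<ge> 0"
  shows "(u - v) \<bullet> (A *v (u - v)) \<le> 2 * (u \<bullet> (A *v u) + v \<bullet> (A *v v))"
  using assms[of "u + v"]
  by (simp add: matrix_vector_right_distrib matrix_vector_mult_diff_distrib inner_add_left
      inner_add_right inner_diff_left inner_diff_right)

text \<open>Hadamard is applied to \<open>A\<close>, whose diagonal entries are
  \<open>(xi $ i)\<^sup>2\<close> off \<open>I\<close> and at most \<open>2 n T\<close> on
  \<open>I\<close>. The logarithms of the latter cost exactly one \<open>T\<close>, which the trace
  term of the objective pays for. The additive constant is independent of \<open>xi\<close> and
  \<open>D\<close>.\<close>

lemma pcglasso_obj_ge_frame:
  fixes x :: "nat \<Rightarrow> real^'p"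
  assumes D: "D \<in> S1" and xi: "\<And>i. xi $ i > 0" and "rho \<ge> 0"
    and lab: "labelling n s" and det: "det (frame_mat s x) \<noteq> 0"
    and I: "I = {i. s i \<noteq> 0}" and m: "m = card I" "m > 0"
  shows "pcglasso_obj (sample_cov n x) rho c xi D
    \<ge> 2 * (\<Sum>i\<in>I. ln (xi $ i)) - 2 * c * (\<Sum>i\<in>UNIV. ln (xi $ i))
      + (ln ((det (frame_mat s x))\<^sup>2) - real m * (ln (2 * real n * real m) - 1))"
proof -
  define B Th where "B = frame_mat s x" and "Th = rescaled xi D"
  define A where "A = transpose B ** Th ** B"
  define y where "y = (\<lambda>i. x i - sample_mean n x)"
  define T where "T = trace (sample_cov n x ** Th)"
  have Th: "sym_pos_def_mat Th"
    unfolding Th_def by (rule sym_pos_def_mat_rescaled[OF S1D(1)[OF D] xi])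
  have A: "sym_pos_def_mat A"
    unfolding A_def using Th det by (intro sym_pos_def_mat_congruence) (auto simp: B_def)
  have Apos: "A $ i $ i > 0" for i by (rule sym_pos_def_mat_diag_pos[OF A])
  have "I \<noteq> {}" using m by auto
  then have n: "n > 0" using lab by (auto simp: labelling_def)
  have T_eq: "real n * T = (\<Sum>i<n. y i \<bullet> (Th *v y i))"
    using n by (simp add: T_def trace_sample_cov y_def)
  have nonneg: "u \<bullet> (Th *v u) \<ge> 0" for u by (rule sym_pos_def_matD(3)[OF Th])
  have A_I: "A $ i $ i \<le> 2 * real n * T" if "i \<in> I" for i
  proof -
    have si: "s i < n" "s i \<noteq> 0" using that lab I by (auto simp: labelling_def)
    \<comment> \<open>The sample mean cancels in differences.\<close>
    have "column i B = y (s i) - y 0"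
      using si by (simp add: B_def frame_mat_def column_def vec_eq_iff y_def)
    then have "A $ i $ i \<le> 2 * (y (s i) \<bullet> (Th *v y (s i)) + y 0 \<bullet> (Th *v y 0))"
      using psd_diff_le[of Th, OF nonneg] by (simp add: A_def congruence_diag)
    also have "\<dots> = 2 * (\<Sum>k\<in>{s i, 0}. y k \<bullet> (Th *v y k))"
      using si by simp
    also have "\<dots> \<le> 2 * (\<Sum>k<n. y k \<bullet> (Th *v y k))"
      using si n nonneg by (intro mult_left_mono sum_mono2) auto
    finally show ?thesis using T_eq by simp
  qed
  have A_nI: "A $ i $ i = (xi $ i)\<^sup>2" if "i \<notin> I" for i
  proof -
    have "column i B = axis i 1"
      using that by (simp add: I B_def frame_mat_def column_def vec_eq_iff)
    then show ?thesis
      by (simp add: A_def congruence_diag inner_axis_matrix_axis Th_def rescaled_nth S1D(2)[OF D]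
          power2_eq_square)
  qed
  have Tpos: "T > 0"
  proof -
    obtain i where i: "i \<in> I" using \<open>I \<noteq> {}\<close> by blast
    then have "2 * real n * T > 0" using A_I[OF i] Apos[of i] by linarith
    then show ?thesis using n by (simp add: zero_less_mult_iff)
  qed
  have lnA: "ln (A $ i $ i) \<le> T / m + (ln (2 * real n * real m) - 1)" if "i \<in> I" for i
  proof -
    have "ln (A $ i $ i) \<le> ln (2 * real n * T)"
      using A_I[OF that] Apos[of i] by (intro iffD2[OF ln_le_cancel_iff]) linarith+
    \<comment> \<open>Splitting off \<open>m\<close> makes the bounds
      \<open>ln (T / m) \<le> T / m - 1\<close> add up to a single \<open>T\<close> over the
      \<open>m\<close> elements of \<open>I\<close>.\<close>
    also have "2 * real n * T = (2 * real n * real m) * (T / m)"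
      using m(2) by simp
    also have "ln \<dots> = ln (2 * real n * real m) + ln (T / m)"
      using m n Tpos by (intro ln_mult_pos) auto
    also have "ln (T / m) \<le> T / m - 1"
      using m Tpos by (intro ln_le_minus_one) auto
    finally show ?thesis by simp
  qed
  have Dpos: "det D > 0" by (rule Hadamard_inequality(1)[OF S1D(1)[OF D]])
  define P where "P = (\<Prod>i\<in>UNIV. xi $ i)"
  have P: "P > 0" by (simp add: P_def prod_pos xi)
  have lnP: "ln P = (\<Sum>i\<in>UNIV. ln (xi $ i))"
    unfolding P_def by (rule ln_prod) (auto simp: xi less_imp_neq[symmetric])
  have "det A = (det B)\<^sup>2 * (P\<^sup>2 * det D)"
    by (simp add: P_def A_def Th_def rescaled_def det_mul det_diag_mat power2_eq_square mult_ac)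
  then have "ln (det A) = ln ((det B)\<^sup>2) + (2 * (\<Sum>i\<in>UNIV. ln (xi $ i)) + ln (det D))"
    using det Dpos P by (simp add: ln_mult_pos B_def lnP[symmetric] ln_realpow)
  moreover have "ln (det A) \<le> (\<Sum>i\<in>UNIV. ln (A $ i $ i))"
  proof -
    have "ln (det A) \<le> ln (\<Prod>i\<in>UNIV. A $ i $ i)"
      using Hadamard_inequality[OF A] by simp
    also have "\<dots> = (\<Sum>i\<in>UNIV. ln (A $ i $ i))"
      by (rule ln_prod) (auto simp: Apos less_imp_neq[symmetric])
    finally show ?thesis .
  qed
  moreover have "(\<Sum>i\<in>UNIV. ln (A $ i $ i))
      \<le> T + real m * (ln (2 * real n * real m) - 1) + 2 * (\<Sum>i\<in>-I. ln (xi $ i))"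
  proof -
    have "(\<Sum>i\<in>UNIV. ln (A $ i $ i)) = (\<Sum>i\<in>I. ln (A $ i $ i)) + (\<Sum>i\<in>-I. ln (A $ i $ i))"
      using sum.union_disjoint[of I "-I" "\<lambda>i. ln (A $ i $ i)"] by (simp add: Compl_partition)
    also have "(\<Sum>i\<in>I. ln (A $ i $ i)) \<le> (\<Sum>i\<in>I. T / m + (ln (2 * real n * real m) - 1))"
      by (rule sum_mono) (rule lnA)
    also have "\<dots> = T + real m * (ln (2 * real n * real m) - 1)"
      using m \<open>I \<noteq> {}\<close> by (simp add: algebra_simps)
    also have "(\<Sum>i\<in>-I. ln (A $ i $ i)) = 2 * (\<Sum>i\<in>-I. ln (xi $ i))"
      unfolding sum_distrib_left using xi by (intro sum.cong) (auto simp: A_nI ln_realpow)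
    finally show ?thesis by simp
  qed
  moreover have "(\<Sum>i\<in>UNIV. ln (xi $ i)) = (\<Sum>i\<in>I. ln (xi $ i)) + (\<Sum>i\<in>-I. ln (xi $ i))"
    using sum.union_disjoint[of I "-I" "\<lambda>i. ln (xi $ i)"] by (simp add: Compl_partition)
  moreover have "rho * (\<Sum>(i, j) \<in> {(i, j). i \<noteq> j}. \<bar>D $ i $ j\<bar>) \<ge> 0"
    using assms by (intro mult_nonneg_nonneg sum_nonneg) auto
  ultimately show ?thesis
    unfolding pcglasso_obj_rescaled Th_def[symmetric] T_def[symmetric] B_def[symmetric]
    by (simp add: algebra_simps)
qed

subsection \<open>Compactness of sublevel sets\<close>

text \<open>Greedy choice: adjoin a maximiser of \<open>l\<close> over the complement.\<close>

lemma ex_top_subset: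
  fixes l :: "'p::finite \<Rightarrow> real"
  assumes "m \<le> CARD('p)"
  shows "\<exists>I. card I = m \<and> (\<forall>i\<in>I. \<forall>j\<in>-I. l j \<le> l i)"
  using assms
proof (induction m)
  case 0
  then show ?case by (intro exI[of _ "{}"]) simp
next
  case (Suc m)
  then obtain I where I: "card I = m" "\<And>i j. i \<in> I \<Longrightarrow> j \<notin> I \<Longrightarrow> l j \<le> l i" by auto
  have "-I \<noteq> {}"
    using I(1) Suc.prems by (metis Compl_empty_eq boolean_algebra.compl_zero double_compl not_less_eq_eq order_refl)
  then have "Max (l ` (-I)) \<in> l ` (-I)" by (intro Max_in) auto
  then obtain k where kI: "k \<notin> I" and "Max (l ` (-I)) = l k" by auto
  moreover have "l j \<le> Max (l ` (-I))" if "j \<notin> I" for j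
    using that by (intro Max_ge) auto
  ultimately have k: "k \<notin> I" "\<And>j. j \<notin> I \<Longrightarrow> l j \<le> l k" by auto
  show ?case
    using I k by (intro exI[of _ "insert k I"]) auto
qed

lemma real_card_Compl:
  fixes I :: "'p::finite set"
  shows "real (card (-I)) = real CARD('p) - real (card I)"
proof -
  have "card I + card (-I) = CARD('p)"
    using card_Un_disjoint[of I "-I"] by (simp add: Compl_partition)
  then show ?thesis by linarith
qed

text \<open>Sum \<open>l j \<le> l i\<close> over all pairs in \<open>I \<times> -I\<close>: the
  mean over the top set is at least the overall mean.\<close>

lemma sum_top_subset_ge:
  fixes l :: "'p::finite \<Rightarrow> real"
  assumes "card I = m" and top: "\<And>i j. i \<in> I \<Longrightarrow> j \<notin> I \<Longrightarrow> l j \<le> l i"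
  shows "real m * sum l UNIV \<le> real CARD('p) * sum l I"
proof -
  have cI: "real (card (-I)) = real CARD('p) - real m"
    using assms by (simp add: real_card_Compl)
  have "(\<Sum>i\<in>I. \<Sum>j\<in>-I. l j) \<le> (\<Sum>i\<in>I. \<Sum>j\<in>-I. l i)"
    using top by (intro sum_mono) auto
  then have "real m * sum l (-I) \<le> (real CARD('p) - real m) * sum l I"
    using assms cI by (simp add: sum_distrib_left)
  moreover have "sum l UNIV = sum l I + sum l (-I)"
    using sum.union_disjoint[of I "-I" l] by (simp add: Compl_partition)
  ultimately show ?thesis by (simp add: algebra_simps)
qed

lemma bounded_of_subset_sums:
  fixes c K1 K2 :: real
  assumes m: "0 < m" "m < CARD('p::finite)" and c: "0 < c" "c < real m / real CARD('p)"
  shows "\<exists>h. \<forall>l :: 'p \<Rightarrow> real. sum l UNIV \<ge> - K1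
    \<and> (\<forall>I. card I = m \<longrightarrow> 2 * sum l I - 2 * c * sum l UNIV \<le> K2) \<longrightarrow> (\<forall>i. \<bar>l i\<bar> \<le> h)"
proof -
  let ?p = "real CARD('p)"
  \<comment> \<open>With \<open>I\<close> the top \<open>m\<close> indices: \<open>K3\<close> bounds
    the total from above, \<open>K4\<close> the sum over \<open>I\<close> from above,
    \<open>lo\<close> the values on \<open>I\<close> from below, \<open>hi\<close> all values from
    above and \<open>lo'\<close> all values from below, each by means of the previous ones. None
    depends on \<open>l\<close>.\<close>
  define K3 where "K3 = K2 / (2 * (real m / ?p - c))"
  define K4 where "K4 = K2 / 2 + c * K3"
  define lo where "lo = - (K1 + K4) / (?p - real m)"
  define hi where "hi = K4 - (real m - 1) * lo"
  define lo' where "lo' = - K1 - (?p - 1) * hi"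
  have "\<bar>l i\<bar> \<le> \<bar>hi\<bar> + \<bar>lo'\<bar>"
    if s: "sum l UNIV \<ge> - K1"
      and I: "\<And>I. card I = m \<Longrightarrow> 2 * sum l I - 2 * c * sum l UNIV \<le> K2" for l :: "'p \<Rightarrow> real" and i
  proof -
    define s where "s = sum l UNIV"
    obtain I where card: "card I = m" and top: "\<And>i j. i \<in> I \<Longrightarrow> j \<notin> I \<Longrightarrow> l j \<le> l i"
      using ex_top_subset[of m l] m by auto
    have "real m * s \<le> ?p * sum l I"
      unfolding s_def by (rule sum_top_subset_ge[OF card top])
    then have "(real m / ?p) * s \<le> sum l I"
      by (simp add: field_simps)
    then have "s * (2 * (real m / ?p - c)) \<le> K2"
    proof -
      have "s * (2 * (real m / ?p - c)) = 2 * ((real m / ?p) * s) - 2 * c * s"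
        by (simp only: right_diff_distrib mult_ac)
      also have "\<dots> \<le> 2 * sum l I - 2 * c * s"
        using \<open>(real m / ?p) * s \<le> sum l I\<close> by linarith
      also have "\<dots> \<le> K2" using I[OF card] by (simp only: s_def)
      finally show ?thesis .
    qed
    then have s3: "s \<le> K3"
      using c unfolding K3_def by (subst pos_le_divide_eq) auto
    then have "c * s \<le> c * K3" using c by simp
    then have L: "sum l I \<le> K4"
      using I[OF card] by (simp add: K4_def s_def)
    have split: "s = sum l I + sum l (-I)"
      using sum.union_disjoint[of I "-I" l] by (simp add: Compl_partition s_def)
    have cI: "real (card (-I)) = ?p - real m"
      using card by (simp add: real_card_Compl)
    have l_lo: "lo \<le> l k" if "k \<in> I" for k
    proof -
      have "sum l (-I) \<le> real (card (-I)) * l k"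
        using top[OF that] by (intro sum_bounded_above) auto
      then have "- (K1 + K4) \<le> l k * (?p - real m)"
        using split L s cI by (simp add: s_def mult.commute)
      then show ?thesis
        unfolding lo_def using m by (subst pos_divide_le_eq) auto
    qed
    have hi_I: "l k \<le> hi" if "k \<in> I" for k
    proof -
      have "real (card (I - {k})) * lo \<le> sum l (I - {k})"
        using l_lo by (intro sum_bounded_below) auto
      moreover have "sum l I = l k + sum l (I - {k})"
        using that by (intro sum.remove) auto
      moreover have "real (card (I - {k})) = real m - 1"
        using that card m by (simp add: card_Diff_singleton of_nat_diff)
      ultimately show ?thesis using L by (simp add: hi_def)
    qed
    obtain k where "k \<in> I" using card m by (metis card.empty ex_in_conv less_irrefl)
    then have hi: "l j \<le> hi" for j
      using hi_I top by (cases "j \<in> I") (auto intro: order_trans)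
    have "lo' \<le> l i"
    proof -
      have "sum l (UNIV - {i}) \<le> real (card (UNIV - {i})) * hi"
        using hi by (intro sum_bounded_above) auto
      moreover have "sum l UNIV = l i + sum l (UNIV - {i})"
        by (intro sum.remove) auto
      moreover have "real (card (UNIV - {i})) = ?p - 1"
        using m by (simp add: card_Diff_singleton of_nat_diff)
      ultimately show ?thesis using s by (simp add: lo'_def)
    qed
    with hi[of i] show ?thesis by linarith
  qed
  then show ?thesis by blast
qed

lemma ex_labelling:
  fixes I :: "'p::finite set"
  assumes "card I = n - 1" "n > 0"
  shows "\<exists>s. labelling n s \<and> I = {i. s i \<noteq> 0}"
proof -
  have "card I = card {1..<n}" using assms by simp
  then obtain f where f: "bij_betw f I {1..<n}"
    using finite_same_card_bij[of I "{1..<n}"] by auto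
  define s where "s = (\<lambda>i. if i \<in> I then f i else 0)"
  have *: "f i \<in> {1..<n}" if "i \<in> I" for i
    using f that by (auto simp: bij_betw_def)
  have I: "I = {i. s i \<noteq> 0}"
  proof (rule set_eqI)
    fix i show "i \<in> I \<longleftrightarrow> i \<in> {i. s i \<noteq> 0}"
      using *[of i] by (cases "i \<in> I") (auto simp: s_def)
  qed
  moreover have "inj_on s I"
    using f by (simp add: bij_betw_def s_def cong: inj_on_cong)
  moreover have "range s \<subseteq> {..<n}"
    using * assms by (auto simp: s_def)
  ultimately show ?thesis by (auto simp: labelling_def)
qed

text \<open>Only equations and weak inequalities occur, so the set is closed. For
  \<open>e > 0\<close>, semidefiniteness with \<open>e \<le> det D\<close> forces
  definiteness.\<close>

definition bounded_region :: "real \<Rightarrow> real \<Rightarrow> real \<Rightarrow> ((real^'p) \<times> (real^'p^'p)) set" where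
  "bounded_region a b e = {(xi, D). (\<forall>i. a \<le> xi $ i \<and> xi $ i \<le> b)
     \<and> (\<forall>i j. D $ i $ j = D $ j $ i) \<and> (\<forall>i. D $ i $ i = 1)
     \<and> (\<forall>x. 0 \<le> x \<bullet> (D *v x)) \<and> e \<le> det D}"

lemma bounded_region_iff:
  assumes "a > 0" "e > 0"
  shows "(xi, D) \<in> bounded_region a b e \<longleftrightarrow>
    (xi, D) \<in> pcglasso_feasible \<and> (\<forall>i. a \<le> xi $ i \<and> xi $ i \<le> b) \<and> e \<le> det D"
proof -
  have tr: "transpose D = D \<longleftrightarrow> (\<forall>i j. D $ i $ j = D $ j $ i)"
    by (auto simp: transpose_def vec_eq_iff)
  show ?thesis
  proof
    assume L: "(xi, D) \<in> bounded_region a b e"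
    then have "sym_pos_def_mat D"
      using assms by (intro psd_det_nz_imp_sym_pos_def_mat) (auto simp: bounded_region_def tr)
    with L show "(xi, D) \<in> pcglasso_feasible \<and> (\<forall>i. a \<le> xi $ i \<and> xi $ i \<le> b) \<and> e \<le> det D"
      using assms by (auto simp: bounded_region_def pcglasso_feasible_def S1_def intro: less_le_trans)
  next
    assume R: "(xi, D) \<in> pcglasso_feasible \<and> (\<forall>i. a \<le> xi $ i \<and> xi $ i \<le> b) \<and> e \<le> det D"
    then have "sym_pos_def_mat D" by (auto simp: pcglasso_feasible_def S1_def)
    with R show "(xi, D) \<in> bounded_region a b e"
      using sym_pos_def_matD[of D] tr
      by (auto simp: bounded_region_def pcglasso_feasible_def S1_def)
  qed
qed

lemma continuous_on_det:
  fixes f :: "'a::topological_space \<Rightarrow> real^'n^'n"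
  assumes "continuous_on S f"
  shows "continuous_on S (\<lambda>x. det (f x))"
  unfolding det_def using assms by (intro continuous_intros)

lemma compact_bounded_region:
  "compact (bounded_region a b e :: ((real^'p) \<times> (real^'p^'p)) set)"
proof -
  let ?K = "bounded_region a b e :: ((real^'p) \<times> (real^'p^'p)) set"
  have eq: "?K = {z. (\<forall>i. a \<le> fst z $ i \<and> fst z $ i \<le> b)
     \<and> (\<forall>i j. snd z $ i $ j = snd z $ j $ i) \<and> (\<forall>i. snd z $ i $ i = 1)
     \<and> (\<forall>x. 0 \<le> (\<Sum>i\<in>UNIV. x $ i * (\<Sum>j\<in>UNIV. snd z $ i $ j * x $ j))) \<and> e \<le> det (snd z)}"
    by (auto simp: bounded_region_def inner_vec_def matrix_vector_mult_def)
  have "closed ?K"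
    unfolding eq
    by (intro closed_Collect_conj closed_Collect_all closed_Collect_le closed_Collect_eq
        continuous_on_det continuous_intros)
  moreover have "bounded ?K"
  proof -
    have "norm xi \<le> real CARD('p) * (\<bar>a\<bar> + \<bar>b\<bar>) \<and> norm D \<le> real CARD('p) * real CARD('p)"
      if "(xi, D) \<in> ?K" for xi D
    proof
      have "norm xi \<le> (\<Sum>i\<in>UNIV. \<bar>xi $ i\<bar>)" by (rule norm_le_l1_cart)
      also have "\<dots> \<le> (\<Sum>i\<in>(UNIV :: 'p set). \<bar>a\<bar> + \<bar>b\<bar>)"
      proof (rule sum_mono)
        fix i
        have "a \<le> xi $ i" "xi $ i \<le> b" using that by (auto simp: bounded_region_def)
        then show "\<bar>xi $ i\<bar> \<le> \<bar>a\<bar> + \<bar>b\<bar>" by linarith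
      qed
      finally show "norm xi \<le> real CARD('p) * (\<bar>a\<bar> + \<bar>b\<bar>)" by simp
      \<comment> \<open>Cauchy--Schwarz on basis vectors, the diagonal being
        \<open>1\<close>.\<close>
      have D1: "\<bar>D $ i $ j\<bar> \<le> 1" for i j
      proof -
        have "(axis i 1 \<bullet> (D *v axis j 1))\<^sup>2
            \<le> (axis i 1 \<bullet> (D *v axis i 1)) * (axis j 1 \<bullet> (D *v axis j 1))"
          using that by (intro psd_Cauchy_Schwarz)
            (auto simp: bounded_region_def transpose_def vec_eq_iff)
        then have "(D $ i $ j)\<^sup>2 \<le> 1"
          using that by (simp add: inner_axis_matrix_axis bounded_region_def)
        then show ?thesis by (simp add: abs_square_le_1)
      qed
      have row: "norm (D $ i) \<le> real CARD('p)" for i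
      proof -
        have "norm (D $ i) \<le> (\<Sum>j\<in>UNIV. \<bar>D $ i $ j\<bar>)" by (rule norm_le_l1_cart)
        also have "\<dots> \<le> (\<Sum>j\<in>(UNIV :: 'p set). 1)" by (rule sum_mono) (rule D1)
        finally show ?thesis by simp
      qed
      have "norm D \<le> (\<Sum>i\<in>UNIV. norm (D $ i))"
        unfolding norm_vec_def by (rule L2_set_le_sum) simp
      also have "\<dots> \<le> (\<Sum>i\<in>(UNIV :: 'p set). real CARD('p))" by (rule sum_mono) (rule row)
      finally show "norm D \<le> real CARD('p) * real CARD('p)" by simp
    qed
    then have "?K \<subseteq> cball 0 (real CARD('p) * (\<bar>a\<bar> + \<bar>b\<bar>)) \<times> cball 0 (real CARD('p) * real CARD('p))"
      by auto
    then show ?thesis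
      by (rule bounded_subset[rotated]) (intro bounded_Times bounded_cball)
  qed
  ultimately show ?thesis by (simp add: compact_eq_bounded_closed)
qed

lemma continuous_on_pcglasso_obj:
  assumes "a > 0" "e > 0"
  shows "continuous_on (bounded_region a b e) (\<lambda>z. pcglasso_obj S rho c (fst z) (snd z))"
proof -
  have eq: "pcglasso_obj S rho c xi D = - ln (det D) - 2 * c * (\<Sum>i\<in>UNIV. ln (xi $ i))
     + (\<Sum>i\<in>UNIV. \<Sum>j\<in>UNIV. S $ i $ j * (xi $ j * D $ j $ i * xi $ i))
     + rho * (\<Sum>z \<in> {(i, j). i \<noteq> j}. \<bar>D $ fst z $ snd z\<bar>)" for xi D
    unfolding pcglasso_obj_rescaled
    by (simp add: trace_def matrix_matrix_mult_def rescaled_nth case_prod_beta)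
  have "det (snd z) \<noteq> 0 \<and> (\<forall>i. fst z $ i \<noteq> 0)" if "z \<in> bounded_region a b e" for z
  proof -
    have "e \<le> det (snd z)" "\<And>i. a \<le> fst z $ i"
      using that by (auto simp: bounded_region_def)
    with assms show ?thesis by (metis not_le)
  qed
  then show ?thesis
    unfolding eq by (intro continuous_intros continuous_on_det) auto
qed

section \<open>Attainment of the infimum\<close>

lemma mat_1_feasible: "(vec 1, mat 1 :: real^'p^'p) \<in> pcglasso_feasible"
proof -
  have "sym_pos_def_mat (mat 1 :: real^'p^'p)"
    by (simp add: sym_pos_def_mat_def transpose_mat)
  moreover have "(mat 1 :: real^'p^'p) $ i $ i = 1" for i by (simp add: mat_def)
  ultimately show ?thesis by (simp add: pcglasso_feasible_def S1_def)
qed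

text \<open>The deterministic core: the condition on the data mentions neither \<open>rho\<close>
  nor \<open>c\<close>, so one null set serves all parameters.\<close>

lemma pcglasso_has_solution_if_frames_nonsingular:
  fixes x :: "nat \<Rightarrow> real^'p"
  assumes n: "2 \<le> n" "n \<le> CARD('p)"
    and frames: "\<And>s. labelling n s \<Longrightarrow> det (frame_mat s x) \<noteq> 0"
    and rho: "rho \<ge> 0" and c: "0 < c" "c < 1 - real (CARD('p) - (n - 1)) / real CARD('p)"
  shows "pcglasso_has_solution (sample_cov n x) rho c"
proof -
  define m where "m = n - 1"
  have m: "0 < m" "m < CARD('p)" using n by (auto simp: m_def)
  have "real (CARD('p) - (n - 1)) = real CARD('p) - real m"
    using n by (simp add: m_def of_nat_diff)
  then have c': "c < real m / real CARD('p)"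
    using c by (simp add: diff_divide_distrib)
  let ?F = "pcglasso_obj (sample_cov n x) rho c"
  \<comment> \<open>The value at a feasible point; only the sublevel set at this height has to be
    searched.\<close>
  define F0 where "F0 = ?F (vec 1) (mat 1)"
  let ?S = "\<lambda>xi :: real^'p. \<Sum>i\<in>UNIV. ln (xi $ i)"
  have "\<forall>I. \<exists>C. card I = m \<longrightarrow> (\<forall>xi D. (xi, D) \<in> pcglasso_feasible \<longrightarrow>
      2 * (\<Sum>i\<in>I. ln (xi $ i)) - 2 * c * ?S xi + C \<le> ?F xi D)"
  proof
    fix I :: "'p set"
    show "\<exists>C. card I = m \<longrightarrow> (\<forall>xi D. (xi, D) \<in> pcglasso_feasible \<longrightarrow>
      2 * (\<Sum>i\<in>I. ln (xi $ i)) - 2 * c * ?S xi + C \<le> ?F xi D)"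
    proof (cases "card I = m")
      case True
      then obtain s where s: "labelling n s" "I = {i. s i \<noteq> 0}"
        using ex_labelling[of I n] n by (auto simp: m_def)
      show ?thesis
        using pcglasso_obj_ge_frame[OF _ _ rho s(1) frames[OF s(1)] s(2) True[symmetric] m(1)]
        by (intro exI impI allI) (auto simp: pcglasso_feasible_def)
    qed simp
  qed
  then obtain C where C: "\<And>I xi D. card I = m \<Longrightarrow> (xi, D) \<in> pcglasso_feasible \<Longrightarrow>
      2 * (\<Sum>i\<in>I. ln (xi $ i)) - 2 * c * ?S xi + C I \<le> ?F xi D"
    by metis
  \<comment> \<open>There are finitely many \<open>I\<close>, so one constant dominates every
    \<open>C I\<close>.\<close>
  define C0 where "C0 = (\<Sum>I\<in>UNIV. \<bar>C I\<bar>)"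
  have C0: "- C0 \<le> C I" for I
    using member_le_sum[of I UNIV "\<lambda>I. \<bar>C I\<bar>"] by (simp add: C0_def)
  obtain h where h: "\<And>l :: 'p \<Rightarrow> real. sum l UNIV \<ge> - (F0 / (2 * c)) \<Longrightarrow>
      (\<And>I. card I = m \<Longrightarrow> 2 * sum l I - 2 * c * sum l UNIV \<le> F0 + C0) \<Longrightarrow> (\<forall>i. \<bar>l i\<bar> \<le> h)"
    using bounded_of_subset_sums[OF m c(1) c', of "F0 / (2 * c)" "F0 + C0"] by blast
  \<comment> \<open>Obtained from \<open>- ln (det D) - 2 c s \<le> F0\<close> and
    \<open>s \<le> p h\<close>, with \<open>s\<close> the sum of the logarithms.\<close>
  define e where "e = exp (- (F0 + 2 * c * (real CARD('p) * h)))"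
  let ?K = "bounded_region (exp (- h)) (exp h) e :: ((real^'p) \<times> (real^'p^'p)) set"
  have in_K: "(xi, D) \<in> ?K" if feas: "(xi, D) \<in> pcglasso_feasible" and le: "?F xi D \<le> F0" for xi D
  proof -
    have D: "D \<in> S1" and xi: "\<And>i. xi $ i > 0" using feas by (auto simp: pcglasso_feasible_def)
    have lower: "- ln (det D) - 2 * c * ?S xi \<le> ?F xi D" "ln (det D) \<le> 0"
      using pcglasso_obj_ge_logdet[OF D xi rho] by auto
    have "- 2 * c * ?S xi \<le> F0" using lower le by simp
    then have "?S xi \<ge> - (F0 / (2 * c))"
      using c by (simp add: field_simps)
    moreover have "2 * (\<Sum>i\<in>I. ln (xi $ i)) - 2 * c * ?S xi \<le> F0 + C0" if "card I = m" for I
      using C[OF that feas] C0[of I] le by linarith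
    ultimately have bnd: "\<bar>ln (xi $ i)\<bar> \<le> h" for i
      using h[of "\<lambda>i. ln (xi $ i)"] by blast
    have "exp (- h) \<le> xi $ i \<and> xi $ i \<le> exp h" for i
    proof -
      have "- h \<le> ln (xi $ i)" "ln (xi $ i) \<le> h" using bnd[of i] by linarith+
      then have "exp (- h) \<le> exp (ln (xi $ i))" "exp (ln (xi $ i)) \<le> exp h" by simp_all
      then show ?thesis using xi[of i] by simp
    qed
    moreover have "e \<le> det D"
    proof -
      have "?S xi \<le> real CARD('p) * h"
        using bnd by (intro sum_bounded_above) (auto simp: abs_le_iff)
      then have "2 * c * ?S xi \<le> 2 * c * (real CARD('p) * h)"
        using c by (intro mult_left_mono) auto
      then have "- (F0 + 2 * c * (real CARD('p) * h)) \<le> ln (det D)"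
        using lower(1) le by linarith
      then have "e \<le> exp (ln (det D))" by (simp add: e_def)
      then show ?thesis using Hadamard_inequality(1)[OF S1D(1)[OF D]] by simp
    qed
    ultimately show ?thesis
      using feas by (subst bounded_region_iff) (auto simp: e_def)
  qed
  have "(vec 1, mat 1) \<in> ?K"
    by (rule in_K[OF mat_1_feasible]) (simp add: F0_def)
  then obtain z where z: "z \<in> ?K" and min: "\<And>z'. z' \<in> ?K \<Longrightarrow> ?F (fst z) (snd z) \<le> ?F (fst z') (snd z')"
    using continuous_attains_inf[OF compact_bounded_region _ continuous_on_pcglasso_obj]
    by (metis (no_types, lifting) e_def empty_iff exp_gt_zero)
  have zF: "(fst z, snd z) \<in> pcglasso_feasible"
    using z bounded_region_iff[of "exp (- h)" e "fst z" "snd z" "exp h"] by (simp add: e_def)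
  have "?F (fst z) (snd z) \<le> ?F xi D" if "(xi, D) \<in> pcglasso_feasible" for xi D
  proof (cases "?F xi D \<le> F0")
    case True
    then show ?thesis using min[OF in_K[OF that]] by simp
  next
    case False
    then show ?thesis
      using min[OF \<open>(vec 1, mat 1) \<in> ?K\<close>] by (simp add: F0_def)
  qed
  with zF show ?thesis
    unfolding pcglasso_has_solution_def by (intro bexI[of _ z]) auto
qed

theorem theorem1:
  fixes M :: "'a measure" and X :: "nat \<Rightarrow> 'a \<Rightarrow> real^'p"
    and n :: nat and mu :: "real^'p" and Sig :: "real^'p^'p"
  assumes "prob_space M"
    and "CARD('p) \<ge> 2" and "2 \<le> n" and "n \<le> CARD('p)"
    and "sym_pos_def_mat Sig"
    and "prob_space.indep_vars M (\<lambda>_. borel) X {..<n}"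
    and "\<And>i. i < n \<Longrightarrow>
           distributed M lborel (X i) (\<lambda>x. ennreal (mvn_density mu Sig x))"
  shows "AE \<omega> in M. \<forall>rho c. rho \<ge> 0 \<and> c > 0 \<and>
            c < 1 - real (CARD('p) - (n - 1)) / real CARD('p)
          \<longrightarrow> pcglasso_has_solution (sample_cov n (\<lambda>i. X i \<omega>)) rho c"
proof -
  have "AE \<omega> in M. labelling n s \<longrightarrow> det (frame_mat s (\<lambda>i. X i \<omega>)) \<noteq> 0" for s
    using prob_space.AE_frame_mat_nonsingular[OF assms(1,6,7), of n s]
    by (cases "labelling n s") auto
  then have "AE \<omega> in M. \<forall>s. labelling n s \<longrightarrow> det (frame_mat s (\<lambda>i. X i \<omega>)) \<noteq> 0"
    \<comment> \<open>As \<open>'p\<close> is finite, the labellings range over a countable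
      type.\<close>
    by (simp add: AE_all_countable)
  then show ?thesis
    by (rule eventually_mono)
       (auto intro!: pcglasso_has_solution_if_frames_nonsingular assms(3,4))
qed

end
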